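(* Let $A\in\mathbb{R}_+^{n\times n}$ be irreducible with degree of cyclicity $h\in\mathbb{Z}_+$, and let $b\in\mathbb{R}_+^n$ be such that $\operatorname{rank}(\mathrm{conmat}_n(A,b))=n$. Define $$A_{f,i}=\lim_{k\to\infty}\frac{A^{kh}}{\rho(A)^{kh}}A^i,\quad i=0,\dots,h-1,\qquad C_{\lim}=\mathrm{cone}(A_{f,0}b,\dots,A_{f,h-1}b).$$ Then the infinite controllable subset $\mathrm{Conset}_\infty(A,b)$ is polyhedral if and only if there exists $k^*\in\mathbb{Z}_+$ such that $$\mathrm{cone}\big(\mathrm{Conset}_{k^*+1}(A,b)\cup C_{\lim}\big)\subseteq \mathrm{cone}\big(\mathrm{Conset}_{k^*}(A,b)\cup C_{\lim}\big),$$ or, equivalently, such that $$A^{k^*}b\in\mathrm{cone}\big(\{b,Ab,\dots,A^{k^*-1}b\}\cup C_{\lim}\big).$$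
   Context: $\mathbb{R}_+=[0,\infty)$, $\mathbb{Z}_+=\{1,2,\dots\}$. For a set $S$ (or list of vectors, or columns of a matrix) in $\mathbb{R}^n$, $\mathrm{cone}(S)$ is the set of all finite nonnegative linear combinations of elements of $S$. A cone is polyhedral if it is generated by finitely many vectors. A matrix $A\in\mathbb{R}_+^{n\times n}$ is reducible if for some permutation matrix $S$, $S^TAS=\begin{bmatrix} A_{11} & 0 \\ A_{21} & A_{22} \end{bmatrix}$ with square nonempty diagonal blocks; otherwise it is irreducible (a $1\times1$ matrix is regarded as irreducible exactly when its entry is strictly positive, so $\rho(A)>0$). $\rho(A)$ is the spectral radius. An irreducible $A$ has degree of cyclicity $h$ ($1\le h\le n$) if its eigenvalues of modulus $\rho(A)$ are simple and are exactly $\rho(A)e^{2\pi i k/h}$, $k=0,\dots,h-1$. The limits $A_{f,i}$ exist for such $A$. For the system $x(t+1)=Ax(t)+bu(t)$, $x(0)=0$, with scalar inputs $u(t)\ge 0$: $\mathrm{conmat}_k(A,b)=[b\ Ab\ \dots\ A^{k-1}b]$; $\mathrm{Conset}_k(A,b)=\{\sum_{i=1}^{k}A^{i-1}b\,u(k-i): u(0),\dots,u(k-1)\ge 0\}$ for $k\in\mathbb{Z}_+$; $\mathrm{Conset}_{\mathrm f}(A,b)=\bigcup_{k\ge1}\mathrm{Conset}_k(A,b)$; $\mathrm{Conset}_\infty(A,b)=\overline{\mathrm{Conset}_{\mathrm f}(A,b)}$ (Euclidean closure). *)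

theory Defs
  imports "HOL-Analysis.Analysis" "HOL-Computational_Algebra.Polynomial"
begin

(* The product on vec inherited from class times acts entrywise, so the power operator cannot be
   used for powers of a matrix. *)
primrec matpow :: "'a::semiring_1^'n^'n \<Rightarrow> nat \<Rightarrow> 'a^'n^'n" where
  "matpow A 0 = mat 1"
| "matpow A (Suc k) = A ** matpow A k"

(* Index types carry no order; wherever rows or columns are enumerated, index j stands at the
   position idx j, counted from 0. *)
abbreviation idx :: "'n::finite \<Rightarrow> nat" where
  "idx \<equiv> to_nat_on (UNIV :: 'n set)"

lemma bij_idx: "bij_betw (idx :: 'n::finite \<Rightarrow> nat) UNIV {..<CARD('n)}"
  by (simp add: to_nat_on_finite)

definition nonneg_vec :: "real^'n \<Rightarrow> bool" where
  "nonneg_vec b \<longleftrightarrow> (\<forall>i. 0 \<le> b $ i)"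

definition nonneg_mat :: "real^'n^'m \<Rightarrow> bool" where
  "nonneg_mat A \<longleftrightarrow> (\<forall>i j. 0 \<le> A $ i $ j)"

subsection \<open>Irreducibility and cyclicity\<close>

definition permutation_matrix :: "real^'n^'n \<Rightarrow> bool" where
  "permutation_matrix S \<longleftrightarrow>
     (\<exists>p. p permutes UNIV \<and> S = (\<chi> i j. if i = p j then 1 else 0))"

(* m is the size of the upper left diagonal block. *)
definition reducible :: "real^'n^'n \<Rightarrow> bool" where
  "reducible A \<longleftrightarrow>
     (\<exists>S m. permutation_matrix S \<and> 0 < m \<and> m < CARD('n) \<and>
        (\<forall>i j. idx i < m \<and> m \<le> idx j \<longrightarrow> (transpose S ** A ** S) $ i $ j = 0))"

(* A 1x1 matrix is never reducible in the sense above; the zero one is excluded separately. *)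
definition irreducible_mat :: "real^'n^'n \<Rightarrow> bool" where
  "irreducible_mat A \<longleftrightarrow>
     \<not> reducible A \<and> (CARD('n) = 1 \<longrightarrow> (\<forall>i j. 0 < A $ i $ j))"

definition spectrum :: "real^'n^'n \<Rightarrow> complex set" where
  "spectrum A = {z. \<exists>v. v \<noteq> 0 \<and> map_matrix complex_of_real A *v v = z *s v}"

definition spectral_radius :: "real^'n^'n \<Rightarrow> real" where
  "spectral_radius A = Max (cmod ` spectrum A)"

definition charpoly :: "real^'n^'n \<Rightarrow> complex poly" where
  "charpoly A =
     det (\<chi> i j. (if i = j then [:0, 1:] else 0) - [:complex_of_real (A $ i $ j):])"

(* Simplicity is algebraic: z is a root of the characteristic polynomial of order one. *)
definition has_cyclicity_degree :: "real^'n^'n \<Rightarrow> nat \<Rightarrow> bool" where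
  "has_cyclicity_degree A h \<longleftrightarrow>
     1 \<le> h \<and> h \<le> CARD('n) \<and>
     {z \<in> spectrum A. cmod z = spectral_radius A} =
       {complex_of_real (spectral_radius A) * exp (2 * of_real pi * \<i> * of_nat k / of_nat h) |k.
          k < h} \<and>
     (\<forall>z \<in> spectrum A. cmod z = spectral_radius A \<longrightarrow> order z (charpoly A) = 1)"

subsection \<open>Cones\<close>

(* The library predicate cone is closure under nonnegative scaling, without convexity. *)
definition cone_gen :: "'a::real_vector set \<Rightarrow> 'a set" where
  "cone_gen S = {\<Sum>v\<in>T. c v *\<^sub>R v |T c. finite T \<and> T \<subseteq> S \<and> (\<forall>v\<in>T. 0 \<le> c v)}"

lemma cone_gen_eq_convex_cone_hull: "cone_gen S = convex_cone hull S"
proof (rule hull_unique [symmetric])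
  show "S \<subseteq> cone_gen S"
  proof
    fix x assume "x \<in> S"
    then show "x \<in> cone_gen S"
      unfolding cone_gen_def
      by (intro CollectI exI [of _ "{x}"] exI [of _ "\<lambda>_. 1"]) auto
  qed
  show "convex_cone (cone_gen S)"
    unfolding convex_cone_iff
  proof (intro conjI allI ballI impI)
    show "0 \<in> cone_gen S"
      unfolding cone_gen_def by (intro CollectI exI [of _ "{}"]) auto
    fix x assume "x \<in> cone_gen S"
    then obtain T c where T: "finite T" "T \<subseteq> S" "\<forall>v\<in>T. 0 \<le> c v" "x = (\<Sum>v\<in>T. c v *\<^sub>R v)"
      unfolding cone_gen_def by auto
    {
      fix y assume "y \<in> cone_gen S"
      then obtain U d where U: "finite U" "U \<subseteq> S" "\<forall>v\<in>U. 0 \<le> d v" "y = (\<Sum>v\<in>U. d v *\<^sub>R v)"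
        unfolding cone_gen_def by auto
      define e where "e v = (if v \<in> T then c v else 0) + (if v \<in> U then d v else 0)" for v
      have "x = (\<Sum>v\<in>T \<union> U. (if v \<in> T then c v else 0) *\<^sub>R v)"
        unfolding T(4) using T(1) U(1) by (intro sum.mono_neutral_cong_left) auto
      moreover have "y = (\<Sum>v\<in>T \<union> U. (if v \<in> U then d v else 0) *\<^sub>R v)"
        unfolding U(4) using T(1) U(1) by (intro sum.mono_neutral_cong_left) auto
      ultimately have "x + y = (\<Sum>v\<in>T \<union> U. e v *\<^sub>R v)"
        by (simp add: e_def scaleR_add_left sum.distrib)
      then show "x + y \<in> cone_gen S"
        unfolding cone_gen_def using T U
        by (intro CollectI exI [of _ "T \<union> U"] exI [of _ e]) (auto simp: e_def)
    }
    fix a :: real assume "0 \<le> a"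
    then show "a *\<^sub>R x \<in> cone_gen S"
      unfolding cone_gen_def using T
      by (intro CollectI exI [of _ T] exI [of _ "\<lambda>v. a * c v"]) (auto simp: scaleR_sum_right)
  qed
  fix C assume C: "S \<subseteq> C" "convex_cone C"
  show "cone_gen S \<subseteq> C"
  proof
    fix x assume "x \<in> cone_gen S"
    then obtain T c where T: "finite T" "T \<subseteq> S" "\<forall>v\<in>T. 0 \<le> c v" "x = (\<Sum>v\<in>T. c v *\<^sub>R v)"
      unfolding cone_gen_def by auto
    from T(1-3) have "(\<Sum>v\<in>T. c v *\<^sub>R v) \<in> C"
      using C by (induction T rule: finite_induct) (auto simp: convex_cone_iff)
    with T(4) show "x \<in> C" by simp
  qed
qed

definition polyhedral_cone :: "'a::real_vector set \<Rightarrow> bool" where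
  "polyhedral_cone C \<longleftrightarrow> (\<exists>F. finite F \<and> C = cone_gen F)"

subsection \<open>Controllable subsets\<close>

(* The number of columns is that of the index type of the result; column j is A^(idx j) b. *)
definition conmat :: "real^'n^'n \<Rightarrow> real^'n \<Rightarrow> real^'k^'n" where
  "conmat A b = (\<chi> i j. (matpow A (idx j) *v b) $ i)"

definition Conset :: "nat \<Rightarrow> real^'n^'n \<Rightarrow> real^'n \<Rightarrow> (real^'n) set" where
  "Conset k A b =
     {\<Sum>i=1..k. u (k - i) *\<^sub>R (matpow A (i - 1) *v b) |u :: nat \<Rightarrow> real. \<forall>t<k. 0 \<le> u t}"

definition Conset_f :: "real^'n^'n \<Rightarrow> real^'n \<Rightarrow> (real^'n) set" where
  "Conset_f A b = (\<Union>k\<in>{1..}. Conset k A b)"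

definition Conset_inf :: "real^'n^'n \<Rightarrow> real^'n \<Rightarrow> (real^'n) set" where
  "Conset_inf A b = closure (Conset_f A b)"

definition A_f :: "real^'n^'n \<Rightarrow> nat \<Rightarrow> nat \<Rightarrow> real^'n^'n" where
  "A_f A h i =
     lim (\<lambda>k. ((1 / spectral_radius A ^ (k * h)) *\<^sub>R matpow A (k * h)) ** matpow A i)"

definition C_lim :: "real^'n^'n \<Rightarrow> nat \<Rightarrow> real^'n \<Rightarrow> (real^'n) set" where
  "C_lim A h b = cone_gen ((\<lambda>i. A_f A h i *v b) ` {0..<h})"

end

theory Submission
  imports Defs "HOL-Computational_Algebra.Fundamental_Theorem_Algebra"
begin

text \<open>Put \<open>x\<^sub>k = A\<^sup>k b / \<rho>(A)\<^sup>k\<close>. As \<open>b\<close> is a cyclic vector, the roots of its minimal polynomial \<open>p\<close> are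
  the eigenvalues of \<open>A\<close>, and the simple peripheral ones split off as a factor of \<open>p\<close> dividing
  \<open>x\<^sup>h - \<rho>(A)\<^sup>h\<close>; the cofactor has smaller roots. Hence each subsequence \<open>(x\<^bsub>kh+i\<^esub>)\<^sub>k\<close> converges, its
  limit being a positive multiple of \<open>A\<^bsub>f,i\<^esub> b\<close>, and this limit is nonzero, since otherwise the
  scaled powers \<open>A\<^bsup>kh\<^esup> / \<rho>(A)\<^bsup>kh\<^esup>\<close> would tend to \<open>0\<close>, against the existence of a peripheral eigenvector.

  If \<open>A\<^sup>k b\<close> lies in \<open>K = cone({b, \<dots>, A\<^bsup>k-1\<^esup> b} \<union> C\<^bsub>lim\<^esub>)\<close>, then \<open>K\<close> is an \<open>A\<close>-invariant closed cone
  containing \<open>b\<close> and hence equals the infinite controllable subset. Conversely, the \<open>x\<^sub>k\<close> together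
  with their limit points form a compact set of nonzero nonnegative vectors, so the cone over it is
  closed and is the infinite controllable subset. If this cone has finitely many generators, they
  involve only finitely many \<open>x\<^sub>k\<close> and limit points, and all \<open>A\<^sup>k b\<close> with \<open>k\<close> large lie in the cone
  generated by these.\<close>

subsection \<open>Polynomials acting on vectors\<close>

text \<open>Horner evaluation of p(M) v. It works on vectors because the class product on
  \<open>vec\<close> is entrywise, so a matrix cannot be plugged into \<open>poly\<close>.\<close>

definition poly_act :: "'a::field^'n^'n \<Rightarrow> 'a poly \<Rightarrow> 'a^'n \<Rightarrow> 'a^'n" where
  "poly_act M p v = fold_coeffs (\<lambda>a u. a *s v + M *v u) p 0"

lemma poly_act_0 [simp]: "poly_act M 0 v = 0"
  by (simp add: poly_act_def)

lemma poly_act_pCons [simp]: "poly_act M (pCons a p) v = a *s v + M *v poly_act M p v"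
  by (cases "p = 0 \<and> a = 0")
    (auto simp: poly_act_def fold_coeffs_pCons_coeff_not_0_eq fold_coeffs_pCons_not_0_0_eq)

lemma poly_act_zero_vec [simp]: "poly_act M p 0 = 0"
  by (induction p) auto

lemma poly_act_add: "poly_act M (p + q) v = poly_act M p v + poly_act M q v"
  by (induction p q rule: poly_induct2)
    (auto simp: vec.scale_left_distrib matrix_vector_right_distrib algebra_simps)

lemma poly_act_smult: "poly_act M (smult c p) v = c *s poly_act M p v"
  by (induction p) (auto simp: vec.scale_right_distrib vec.scale)

lemma poly_act_mult: "poly_act M (p * q) v = poly_act M p (poly_act M q v)"
  by (induction p) (auto simp: poly_act_add poly_act_smult)

lemma poly_act_minus: "poly_act M (- p) v = - poly_act M p v"
  using poly_act_smult [of M "-1" p v] by simp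

lemma poly_act_diff: "poly_act M (p - q) v = poly_act M p v - poly_act M q v"
  using poly_act_add [of M p "- q" v] by (simp add: poly_act_minus)

lemma poly_act_monom: "poly_act M (monom c k) v = c *s (matpow M k *v v)"
  by (induction k) (auto simp: monom_0 monom_Suc vec.scale matrix_vector_mul_assoc)

lemma poly_act_linear: "poly_act M [:- z, 1:] v = M *v v - z *s v"
  by simp

lemma poly_act_eigenvector:
  assumes "M *v v = z *s v"
  shows "poly_act M p v = poly p z *s v"
  using assms by (induction p) (auto simp: vec.scale vec.scale_left_distrib mult.commute)

lemma matpow_add: "matpow M (i + j) = matpow M i ** matpow M j"
  by (induction i) (auto simp: matrix_mul_assoc)

lemma matpow_commute: "matpow M i ** matpow M j = matpow M j ** matpow M i"
  by (metis add.commute matpow_add)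

text \<open>Distinct linear factors split off one at a time: a new root is not a root of the factors
  already removed, hence it is a root of the cofactor.\<close>

lemma prod_root_factors_dvd:
  fixes p :: "'a::field poly"
  assumes "finite S" "\<And>z. z \<in> S \<Longrightarrow> poly p z = 0"
  shows "(\<Prod>z\<in>S. [:- z, 1:]) dvd p"
  using assms
proof (induction S rule: finite_induct)
  case (insert z S)
  then obtain r where r: "p = (\<Prod>z\<in>S. [:- z, 1:]) * r"
    by (auto elim: dvdE)
  have "poly (\<Prod>z\<in>S. [:- z, 1:]) z \<noteq> 0"
    using insert.hyps by (auto simp: poly_prod)
  then have "poly r z = 0"
    using insert.prems r by (metis insertI1 mult_eq_0_iff poly_mult)
  then have "[:- z, 1:] dvd r"
    by (simp add: poly_eq_0_iff_dvd)
  then show ?case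
    using insert.hyps r by (metis mult.commute mult_dvd_mono dvd_refl prod.insert)
qed simp

subsection \<open>Jordan chains and the characteristic polynomial\<close>

lemma poly_det: "poly (det M) x = det (map_matrix (\<lambda>p. poly p x) M)"
  for M :: "'a::comm_ring_1 poly^'n^'n"
  by (simp add: det_def poly_sum poly_prod poly_of_int)

lemma poly_charpoly: "poly (charpoly A) x = det (mat x - map_matrix complex_of_real A)"
  unfolding charpoly_def poly_det by (rule arg_cong [where f = det]) (auto simp: vec_eq_iff mat_def)

lemma mat_mult_vec: "mat c *v v = c *s v"
  by (simp add: vec_eq_iff matrix_vector_mult_def mat_def if_distrib if_distribR cong: if_cong)

lemma charpoly_root_imp_spectrum:
  assumes "poly (charpoly A) z = 0"
  shows "z \<in> spectrum A"
proof -
  have "\<not> invertible (mat z - map_matrix complex_of_real A)"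
    using assms by (simp add: invertible_det_nz poly_charpoly)
  then obtain v where "v \<noteq> 0" "(mat z - map_matrix complex_of_real A) *v v = 0"
    unfolding invertible_left_inverse matrix_left_invertible_ker by auto
  then show ?thesis
    by (auto simp: spectrum_def matrix_vector_mult_diff_rdistrib mat_mult_vec)
qed

text \<open>With \<open>M = xI - A\<close> and \<open>u = (x - z) w + v\<close> one has \<open>M u = (x - z)\<^sup>2 w\<close>, so by Cramer's rule
  \<open>(x - z)\<^sup>2\<close> divides \<open>u\<^sub>j det M\<close>, while \<open>u\<^sub>j\<close> does not vanish at \<open>z\<close> if \<open>v\<^sub>j \<noteq> 0\<close>.\<close>

lemma jordan_chain_order_charpoly:
  assumes nz: "charpoly A \<noteq> 0" and "v \<noteq> 0"
    and v: "map_matrix complex_of_real A *v v = z *s v"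
    and w: "map_matrix complex_of_real A *v w = z *s w + v"
  shows "order z (charpoly A) \<noteq> 1"
proof -
  obtain j where j: "v $ j \<noteq> 0"
    using \<open>v \<noteq> 0\<close> by (auto simp: vec_eq_iff)
  \<comment> \<open>\<open>u\<close> is the \<open>j\<close>-th entry of (x - z) w + v as a
    polynomial in x, and \<open>R\<close> is the determinant of xI - A with column \<open>j\<close>
    replaced by \<open>w\<close>.\<close>
  define u where "u = [:v $ j - z * w $ j, w $ j:]"
  define R where "R = det (\<chi> i k. if k = j then [:w $ i:] else
    (if i = k then [:0, 1:] else 0) - [:complex_of_real (A $ i $ k):])"
  \<comment> \<open>The identity is checked at each complex x, where Cramer's rule applies over a
    field; equal values then give equal polynomials.\<close>
  have "poly (u * charpoly A) x = poly ([:- z, 1:] ^ 2 * R) x" for x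
  proof -
    define N where "N = mat x - map_matrix complex_of_real A"
    have N: "N *v ((x - z) *s w + v) = (x - z)^2 *s w"
      unfolding N_def matrix_vector_mult_diff_rdistrib matrix_vector_right_distrib vec.scale v w
        mat_mult_vec
      by (simp add: vec_eq_iff power2_eq_square algebra_simps)
    have R: "poly R x = det (\<chi> i k. if k = j then w $ i else N $ i $ k)"
      unfolding R_def poly_det
      by (rule arg_cong [where f = det]) (auto simp: vec_eq_iff N_def mat_def)
    have "poly u x * det N = ((x - z) *s w + v) $ j * det N"
      by (simp add: u_def algebra_simps)
    also have "\<dots> = det (\<chi> i k. if k = j then (x - z)^2 * w $ i else N $ i $ k)"
      unfolding cramer_lemma [symmetric] N
      by (rule arg_cong [where f = det]) (auto simp: vec_eq_iff)
    also have "\<dots> = (x - z)^2 * poly R x"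
    proof -
      have "det (\<chi> i k. if k = j then (x - z)^2 * w $ i else N $ i $ k)
        = det (transpose (\<chi> i k. if k = j then (x - z)^2 * w $ i else N $ i $ k))"
        by (simp add: det_transpose)
      also have "\<dots> = det (\<chi> k. if k = j then (x - z)^2 *s w else column k N)"
        by (rule arg_cong [where f = det]) (auto simp: vec_eq_iff transpose_def column_def)
      also have "\<dots> = (x - z)^2 * det (\<chi> k. if k = j then w else column k N)"
        by (rule det_row_mul)
      also have "det (\<chi> k. if k = j then w else column k N)
        = det (transpose (\<chi> i k. if k = j then w $ i else N $ i $ k))"
        by (rule arg_cong [where f = det]) (auto simp: vec_eq_iff transpose_def column_def)
      finally show ?thesis
        by (simp add: R det_transpose)
    qed
    finally show ?thesis
      by (simp add: poly_charpoly N_def)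
  qed
  then have eq: "u * charpoly A = [:- z, 1:] ^ 2 * R"
    by (subst poly_eq_poly_eq_iff [symmetric]) auto
  have uz: "poly u z \<noteq> 0"
    using j by (simp add: u_def)
  then have nz': "u * charpoly A \<noteq> 0"
    using nz by auto
  have "2 \<le> order z (u * charpoly A)"
    using nz' order_divides [of z 2 "u * charpoly A"] eq by (metis dvd_triv_left)
  also have "\<dots> = order z (charpoly A)"
    using order_mult [OF nz'] uz by (simp add: order_0I)
  finally show ?thesis by simp
qed

subsection \<open>The minimal polynomial of a cyclic vector\<close>

text \<open>A polynomial of least degree annihilating \<open>b\<close> annihilates every vector,
  since each vector is q(M) b and polynomials in M commute.\<close>

lemma cyclic_min_poly:
  assumes cyc: "\<And>v. \<exists>q. degree q < N \<and> v = poly_act M q b"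
  obtains p where "p \<noteq> 0" "\<And>v. poly_act M p v = 0"
    "\<And>q. q \<noteq> 0 \<Longrightarrow> degree q < degree p \<Longrightarrow> poly_act M q b \<noteq> 0"
proof -
  define P where "P p \<longleftrightarrow> p \<noteq> 0 \<and> poly_act M p b = 0" for p
  obtain q where q: "degree q < N" "matpow M N *v b = poly_act M q b"
    using cyc by blast
  \<comment> \<open>Nonzero because \<open>q\<close> has degree below \<open>N\<close>.\<close>
  have "P (monom 1 N - q)"
    using q by (auto simp: P_def poly_act_diff poly_act_monom degree_monom_eq)
  then obtain p where p: "P p" "\<And>q. P q \<Longrightarrow> degree p \<le> degree q"
    using ex_has_least_nat [of P _ degree] by blast
  show thesis
  proof
    fix v
    obtain q where "v = poly_act M q b"
      using cyc by blast
    then show "poly_act M p v = 0"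
      using p(1) by (metis P_def mult.commute poly_act_mult poly_act_zero_vec)
  qed (use p in \<open>auto simp: P_def not_less [symmetric]\<close>)
qed

text \<open>At a root z, the cofactor of x - z has too small a degree to annihilate
  \<open>b\<close>, so it sends \<open>b\<close> to an eigenvector. Conversely, p(M) acts on an
  eigenvector as the scalar p(z).\<close>

lemma min_poly_root_iff:
  assumes "p \<noteq> 0" "\<And>v. poly_act M p v = 0"
    and "\<And>q. q \<noteq> 0 \<Longrightarrow> degree q < degree p \<Longrightarrow> poly_act M q b \<noteq> 0"
  shows "poly p z = 0 \<longleftrightarrow> (\<exists>v. v \<noteq> 0 \<and> M *v v = z *s v)"
proof
  assume "poly p z = 0"
  then obtain r where r: "p = [:- z, 1:] * r"
    by (auto simp: poly_eq_0_iff_dvd elim: dvdE)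
  have "r \<noteq> 0"
    using r assms(1) by auto
  moreover have "degree p = Suc (degree r)"
    using \<open>r \<noteq> 0\<close> by (simp add: r degree_mult_eq del: mult_pCons_left)
  ultimately have "poly_act M r b \<noteq> 0"
    using assms(3) by simp
  moreover have "M *v poly_act M r b - z *s poly_act M r b = 0"
    using assms(2) [of b] unfolding r poly_act_mult poly_act_linear .
  ultimately show "\<exists>v. v \<noteq> 0 \<and> M *v v = z *s v"
    by auto
next
  assume "\<exists>v. v \<noteq> 0 \<and> M *v v = z *s v"
  then show "poly p z = 0"
    using assms(2) by (metis poly_act_eigenvector vector_mul_eq_0)
qed

text \<open>The chain is \<open>w\<close> = r(M) b and \<open>v\<close> = (M - z) r(M) b, with
  \<open>v\<close> nonzero by minimality. It serves to pass from algebraic simplicity of an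
  eigenvalue to simplicity as a root of \<open>p\<close>.\<close>

lemma min_poly_double_root:
  assumes "p \<noteq> 0" "\<And>v. poly_act M p v = 0"
    and "\<And>q. q \<noteq> 0 \<Longrightarrow> degree q < degree p \<Longrightarrow> poly_act M q b \<noteq> 0"
    and p: "p = [:- z, 1:] * ([:- z, 1:] * r)"
  obtains v w where "v \<noteq> 0" "M *v v = z *s v" "M *v w = z *s w + v"
proof
  let ?r = "[:- z, 1:] * r"
  let ?v = "poly_act M ?r b" and ?w = "poly_act M r b"
  have "?r \<noteq> 0"
    using p assms(1) by auto
  moreover have "degree p = Suc (degree ?r)"
    unfolding p using \<open>?r \<noteq> 0\<close> by (subst degree_mult_eq) auto
  ultimately show "?v \<noteq> 0"
    using assms(3) by (metis lessI)
  have "M *v ?v - z *s ?v = 0"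
    using assms(2) [of b] unfolding p poly_act_mult [of _ "[:- z, 1:]" ?r] poly_act_linear .
  then show "M *v ?v = z *s ?v"
    by simp
  show "M *v ?w = z *s ?w + ?v"
    unfolding poly_act_mult poly_act_linear by simp
qed

subsection \<open>Convergence of the powers\<close>

text \<open>Summing the recursion bounds a partial sum S by \<open>a 0\<close> + t S +
  \<open>suminf e\<close>, and t < 1 allows solving for S.\<close>

lemma summable_contraction:
  fixes a e :: "nat \<Rightarrow> real"
  assumes "\<And>k. 0 \<le> a k" "\<And>k. 0 \<le> e k" "summable e" "t < 1"
    and step: "\<And>k. a (Suc k) \<le> t * a k + e k"
  shows "summable a"
proof (rule summableI_nonneg_bounded)
  fix n
  have "sum a {..<n} \<le> sum a {..<Suc n}"
    using assms(1) by simp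
  also have "\<dots> = a 0 + (\<Sum>k<n. a (Suc k))"
    by (rule sum.lessThan_Suc_shift)
  also have "\<dots> \<le> a 0 + (\<Sum>k<n. t * a k + e k)"
    using step by (intro add_left_mono sum_mono)
  also have "\<dots> = a 0 + t * sum a {..<n} + sum e {..<n}"
    by (simp add: sum.distrib sum_distrib_left)
  also have "\<dots> \<le> a 0 + t * sum a {..<n} + suminf e"
    using assms(2,3) by (simp add: sum_le_suminf)
  finally have "(1 - t) * sum a {..<n} \<le> a 0 + suminf e"
    by (simp add: algebra_simps)
  then show "sum a {..<n} \<le> (a 0 + suminf e) / (1 - t)"
    using \<open>t < 1\<close> by (simp add: pos_le_divide_eq mult.commute)
qed (use assms in auto)

text \<open>Induction on the degree stands in for a Jordan decomposition. For a root z of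
  \<open>q\<close>, the vector w' = (M - z) w is annihilated by the cofactor, and M^(k+1) w = z M^k
  w + M^k w' is a contraction by |z|/r with a summable error.\<close>

lemma summable_matpow_small_roots:
  fixes M :: "complex^'n^'n"
  assumes "0 < r" "q \<noteq> 0" "\<And>z. poly q z = 0 \<Longrightarrow> cmod z < r" "poly_act M q w = 0"
  shows "summable (\<lambda>k. cmod ((matpow M k *v w) $ j) / r ^ k)"
  using assms(2-)
proof (induction "degree q" arbitrary: q w)
  case 0
  then obtain c where "q = [:c:]" "c \<noteq> 0"
    by (metis degree_eq_zeroE pCons_0_0)
  then show ?case
    using 0 by simp
next
  case (Suc n)
  then have "\<not> constant (poly q)"
    by (simp add: constant_degree)
  then obtain z where z: "poly q z = 0"
    using fundamental_theorem_of_algebra by blast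
  then obtain q' where q: "q = q' * [:- z, 1:]"
    by (metis dvdE mult.commute poly_eq_0_iff_dvd)
  have "q' \<noteq> 0"
    using q Suc.prems by auto
  define w' where "w' = M *v w - z *s w"
  have "poly_act M q' w' = 0"
    using Suc.prems(3) unfolding q poly_act_mult poly_act_linear w'_def .
  moreover have "n = degree q'"
    using Suc.hyps(2) \<open>q' \<noteq> 0\<close> by (simp add: q degree_mult_eq del: mult_pCons_right)
  moreover have "cmod y < r" if "poly q' y = 0" for y
    using Suc.prems(2) that by (simp add: q)
  ultimately have *: "summable (\<lambda>k. cmod ((matpow M k *v w') $ j) / r ^ k)"
    using Suc.hyps(1) \<open>q' \<noteq> 0\<close> by blast
  let ?e = "\<lambda>k. cmod ((matpow M k *v w') $ j) / r ^ k / r"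
  have e: "summable ?e"
    using * by (rule summable_divide)
  show ?case
  proof (rule summable_contraction [where e = ?e and t = "cmod z / r"])
    fix k
    have "matpow M (Suc k) *v w = matpow M k *v (M *v w)"
      using matpow_commute [of M 1 k] by (simp add: matrix_vector_mul_assoc)
    also have "\<dots> = z *s (matpow M k *v w) + matpow M k *v w'"
      by (simp add: w'_def vec.diff vec.scale)
    finally have "cmod ((matpow M (Suc k) *v w) $ j)
        \<le> cmod z * cmod ((matpow M k *v w) $ j) + cmod ((matpow M k *v w') $ j)"
      by (metis norm_mult norm_triangle_ineq vector_add_component vector_smult_component)
    then have "cmod ((matpow M (Suc k) *v w) $ j) / r ^ Suc k
        \<le> (cmod z * cmod ((matpow M k *v w) $ j) + cmod ((matpow M k *v w') $ j)) / r ^ Suc k"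
      using \<open>0 < r\<close> by (intro divide_right_mono) auto
    then show "cmod ((matpow M (Suc k) *v w) $ j) / r ^ Suc k
        \<le> cmod z / r * (cmod ((matpow M k *v w) $ j) / r ^ k) + ?e k"
      by (simp add: add_divide_distrib mult.commute)
  qed (use e z Suc.prems(2) \<open>0 < r\<close> in auto)
qed

text \<open>Telescoping: consecutive terms differ by the \<open>j\<close>-th entry of \<open>M\<^bsup>kh\<^esup> w\<close> up to scaling, where
  \<open>w = (M\<^sup>h - r\<^sup>h) v\<close> is annihilated by the factor of \<open>p\<close> with small roots.\<close>

lemma convergent_matpow:
  fixes M :: "complex^'n^'n"
  assumes "0 < r" "1 \<le> h" "q \<noteq> 0" "\<And>z. poly q z = 0 \<Longrightarrow> cmod z < r"
    and ann: "poly_act M (s * q) v = 0"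
    and st: "monom 1 h - [:of_real (r ^ h):] = s * t"
  shows "convergent (\<lambda>k. (matpow M (k * h) *v v) $ j / of_real (r ^ (k * h)))"
proof -
  define w where "w = matpow M h *v v - of_real (r ^ h) *s v"
  define a where "a k = (matpow M (k * h) *v v) $ j / of_real (r ^ (k * h))" for k
  have "w = poly_act M (s * t) v"
    unfolding st [symmetric] by (simp add: w_def poly_act_diff poly_act_monom)
  then have "poly_act M q w = poly_act M t (poly_act M (s * q) v)"
    by (simp add: ac_simps flip: poly_act_mult)
  then have "poly_act M q w = 0"
    using ann by simp
  then have "summable (\<lambda>k. cmod ((matpow M k *v w) $ j) / r ^ k)"
    using assms by (intro summable_matpow_small_roots)
  then have "summable ((\<lambda>k. cmod ((matpow M k *v w) $ j) / r ^ k) \<circ> (\<lambda>k. k * h))"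
    using assms by (intro summable_reindex) (auto simp: inj_on_def)
  then have "summable (\<lambda>k. cmod ((matpow M (k * h) *v w) $ j) / r ^ (k * h) / r ^ h)"
    unfolding o_def by (rule summable_divide)
  moreover have "cmod (a (Suc k) - a k) = cmod ((matpow M (k * h) *v w) $ j) / r ^ (k * h) / r ^ h"
    for k
  proof -
    have "matpow M (Suc k * h) *v v = matpow M (k * h) *v w + of_real (r ^ h) *s (matpow M (k * h) *v v)"
      by (simp add: w_def vec.diff vec.scale matrix_vector_mul_assoc add.commute [of h]
          flip: matpow_add)
    then have "a (Suc k) - a k = (matpow M (k * h) *v w) $ j / of_real (r ^ (k * h)) / of_real (r ^ h)"
      using \<open>0 < r\<close> by (simp add: a_def field_simps power_add)
    then show ?thesis
      using \<open>0 < r\<close> by (simp add: norm_divide norm_mult norm_power)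
  qed
  ultimately have "summable (\<lambda>k. a (Suc k) - a k)"
    by (intro summable_norm_cancel [of "\<lambda>k. a (Suc k) - a k"]) simp
  then have "(\<lambda>n. a n - a 0) \<longlonglongrightarrow> (\<Sum>k. a (Suc k) - a k)"
    using summable_LIMSEQ by (fastforce simp: sum_lessThan_telescope)
  then have "(\<lambda>n. (a n - a 0) + a 0) \<longlonglongrightarrow> (\<Sum>k. a (Suc k) - a k) + a 0"
    by (intro tendsto_intros)
  then show ?thesis
    by (auto simp: a_def [abs_def] convergent_def)
qed

subsection \<open>The limit matrix\<close>

abbreviation cmat :: "real^'n^'m \<Rightarrow> complex^'n^'m" where
  "cmat \<equiv> map_matrix complex_of_real"

lemma cmat_mult: "cmat (A ** B) = cmat A ** cmat B"
  by (simp add: vec_eq_iff matrix_matrix_mult_def)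

lemma cmat_matpow: "matpow (cmat A) k = cmat (matpow A k)"
  by (induction k) (auto simp: cmat_mult, simp add: vec_eq_iff mat_def)

lemma poly_act_sum: "poly_act M (sum f I) v = (\<Sum>i\<in>I. poly_act M (f i) v)"
  by (induction I rule: infinite_finite_induct) (auto simp: poly_act_add)

lemma conmat_spans:
  assumes "rank (conmat A b :: real^'n^'n) = CARD('n)"
  obtains c :: "real^'n" where "x = (\<Sum>j\<in>UNIV. c $ j *s (matpow A (idx j) *v b))"
proof -
  obtain c where "x = (conmat A b :: real^'n^'n) *v c"
    using assms unfolding full_rank_surjective by (metis surjD)
  moreover have "column j (conmat A b :: real^'n^'n) = matpow A (idx j) *v b" for j
    by (simp add: conmat_def column_def vec_eq_iff)
  ultimately show thesis
    by (intro that [of c]) (simp add: matrix_mult_sum)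
qed

text \<open>Full rank makes \<open>b\<close> cyclic over the complex numbers too: real and imaginary
  parts of \<open>v\<close> are expanded separately in the columns, and the two real coefficients of
  a column form one complex coefficient.\<close>

lemma conmat_cyclic:
  fixes A :: "real^'n^'n"
  assumes "rank (conmat A b :: real^'n^'n) = CARD('n)"
  shows "\<exists>q. degree q < CARD('n) \<and> v = poly_act (cmat A) q (\<chi> i. complex_of_real (b $ i))"
proof -
  obtain c :: "real^'n" where c: "(\<chi> i. Re (v $ i)) = (\<Sum>j\<in>UNIV. c $ j *s (matpow A (idx j) *v b))"
    by (rule conmat_spans [OF assms, of "\<chi> i. Re (v $ i)"])
  obtain d :: "real^'n" where d: "(\<chi> i. Im (v $ i)) = (\<Sum>j\<in>UNIV. d $ j *s (matpow A (idx j) *v b))"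
    by (rule conmat_spans [OF assms, of "\<chi> i. Im (v $ i)"])
  define q where "q = (\<Sum>j\<in>UNIV. monom (Complex (c $ j) (d $ j)) (idx (j::'n)))"
  have "idx (j::'n) < CARD('n)" for j
    using bij_idx [where 'n = 'n] by (auto simp: bij_betw_def)
  then have "degree q < CARD('n)"
    unfolding q_def by (intro degree_sum_less) (auto intro: le_less_trans [OF degree_monom_le])
  moreover have "v = poly_act (cmat A) q (\<chi> i. complex_of_real (b $ i))"
  proof (intro vec_eq_iff [THEN iffD2] allI)
    fix i
    have "cmat B *v (\<chi> i. complex_of_real (b $ i)) = (\<chi> i. complex_of_real ((B *v b) $ i))" for B :: "real^'n^'n"
      by (simp add: vec_eq_iff matrix_vector_mult_def)
    then have "poly_act (cmat A) q (\<chi> i. complex_of_real (b $ i)) $ i =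
        (\<Sum>j\<in>UNIV. Complex (c $ j) (d $ j) * of_real ((matpow A (idx j) *v b) $ i))"
      by (simp add: q_def poly_act_sum poly_act_monom cmat_matpow)
    also have "\<dots> = Complex (Re (v $ i)) (Im (v $ i))"
      using arg_cong [OF c, of "\<lambda>x. x $ i"] arg_cong [OF d, of "\<lambda>x. x $ i"]
      by (simp add: complex_eq_iff)
    finally show "v $ i = poly_act (cmat A) q (\<chi> i. complex_of_real (b $ i)) $ i"
      by simp
  qed
  ultimately show ?thesis by blast
qed

text \<open>Used to obtain a positive spectral radius. For n > 1 the identity permutation with block
  size 1 shows the zero matrix reducible.\<close>

lemma irreducible_mat_nonzero: "\<not> irreducible_mat 0"
proof
  assume *: "irreducible_mat (0 :: real^'n^'n)"
  show False
  proof (cases "CARD('n) = 1")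
    case True
    with * show False
      by (simp add: irreducible_mat_def)
  next
    case False
    then have "1 < CARD('n)"
      by (metis One_nat_def Suc_lessI zero_less_card_finite)
    moreover have "permutation_matrix (mat 1 :: real^'n^'n)"
      unfolding permutation_matrix_def mat_def by (intro exI [of _ id]) (auto simp: permutes_id)
    ultimately have "reducible (0 :: real^'n^'n)"
      unfolding reducible_def
      by (intro exI [of _ "mat 1"] exI [of _ 1]) (auto simp: matrix_matrix_mult_def)
    with * show False
      by (simp add: irreducible_mat_def)
  qed
qed

lemma cyclicity_degree_limit:
  fixes A :: "real^'n^'n"
  assumes irr: "irreducible_mat A" and cyc: "has_cyclicity_degree A h"
    and rank: "rank (conmat A b :: real^'n^'n) = CARD('n)"
  shows "0 < spectral_radius A" and "\<exists>z\<in>spectrum A. cmod z = spectral_radius A"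
    and "convergent (\<lambda>k. (1 / spectral_radius A ^ (k * h)) *\<^sub>R matpow A (k * h))"
proof -
  define r where "r = spectral_radius A"
  obtain p where p: "p \<noteq> 0" "\<And>v. poly_act (cmat A) p v = 0"
    and min: "\<And>q. q \<noteq> 0 \<Longrightarrow> degree q < degree p
      \<Longrightarrow> poly_act (cmat A) q (\<chi> i. complex_of_real (b $ i)) \<noteq> 0"
    by (rule cyclic_min_poly [OF conmat_cyclic [OF rank]]) (rule that)
  have spec: "spectrum A = {z. poly p z = 0}"
    using min_poly_root_iff [OF p min] by (auto simp: spectrum_def)
  \<comment> \<open>\<open>Max\<close> in \<open>spectral_radius\<close> is meaningful because the
    spectrum is the root set of a nonconstant polynomial, hence finite and nonempty.\<close>
  have fin: "finite (spectrum A)"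
    unfolding spec using p(1) by (rule poly_roots_finite)
  have "degree p \<noteq> 0"
  proof
    assume "degree p = 0"
    then obtain c where "p = [:c:]"
      by (rule degree_eq_zeroE)
    with p(1) p(2) [of 1] show False
      by (simp add: vec_eq_iff)
  qed
  then have "spectrum A \<noteq> {}"
    using fundamental_theorem_of_algebra [of p] by (auto simp: spec constant_degree)
  then have rho: "r \<in> cmod ` spectrum A" "\<And>z. z \<in> spectrum A \<Longrightarrow> cmod z \<le> r"
    using fin by (auto simp: r_def spectral_radius_def intro!: Max_in)
  \<comment> \<open>Otherwise every complex number would be an eigenvalue, and \<open>order\<close>
    would say nothing about multiplicity.\<close>
  have nz: "charpoly A \<noteq> 0"
  proof
    assume "charpoly A = 0"
    then have "spectrum A = UNIV"
      using charpoly_root_imp_spectrum [of A] by (simp add: set_eq_iff)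
    then show False
      using fin infinite_UNIV_char_0 by metis
  qed
  have simple: "p \<noteq> [:- z, 1:] * ([:- z, 1:] * s)" if "z \<in> spectrum A" "cmod z = r" for z s
  proof
    assume "p = [:- z, 1:] * ([:- z, 1:] * s)"
    then obtain v w where "v \<noteq> 0" "cmat A *v v = z *s v" "cmat A *v w = z *s w + v"
      using min_poly_double_root [OF p min] by metis
    then have "order z (charpoly A) \<noteq> 1"
      using nz by (intro jordan_chain_order_charpoly)
    then show False
      using that cyc by (simp add: has_cyclicity_degree_def r_def)
  qed
  \<comment> \<open>If r = 0, then 0 is the only root of \<open>p\<close>. Either p = c x, which
    forces A = 0, or x^2 divides \<open>p\<close>, against \<open>simple\<close> at the eigenvalue
    0.\<close>
  have "0 < r"
  proof (rule ccontr)
    assume "\<not> 0 < r"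
    then have "r = 0" and zero: "\<And>z. z \<in> spectrum A \<Longrightarrow> z = 0"
      using rho by fastforce+
    then have "0 \<in> spectrum A"
      using \<open>spectrum A \<noteq> {}\<close> by blast
    then obtain s where s: "p = [:- 0, 1:] * s"
      by (metis dvdE mem_Collect_eq poly_eq_0_iff_dvd spec)
    show False
    proof (cases "degree s = 0")
      case True
      then obtain c where c: "s = [:c:]"
        by (rule degree_eq_zeroE)
      then have "c \<noteq> 0"
        using p(1) s by auto
      have "cmat A *v v = 0" for v
        using p(2) [of v] \<open>c \<noteq> 0\<close> by (simp add: s c vec.scale)
      then have "cmat A = 0"
        by (simp add: matrix_eq)
      then have "A = 0"
        by (auto simp: vec_eq_iff)
      then show False
        using irr irreducible_mat_nonzero by blast
    next
      case False
      then obtain z where z: "poly s z = 0"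
        using fundamental_theorem_of_algebra [of s] by (auto simp: constant_degree)
      then have "z \<in> spectrum A"
        using s by (simp add: spec)
      then have "z = 0"
        by (rule zero)
      then obtain s' where "s = [:- 0, 1:] * s'"
        using z by (metis dvdE poly_eq_0_iff_dvd)
      then show False
        using simple [of 0 s'] \<open>0 \<in> spectrum A\<close> \<open>r = 0\<close> s by simp
    qed
  qed
  have "1 \<le> h"
    using cyc by (simp add: has_cyclicity_degree_def)
  define Z where "Z = {z \<in> spectrum A. cmod z = r}"
  define s where "s = (\<Prod>z\<in>Z. [:- z, 1:])"
  have "finite Z"
    using fin by (simp add: Z_def)
  have "s dvd p"
    unfolding s_def by (rule prod_root_factors_dvd) (auto simp: Z_def spec fin [unfolded spec])
  then obtain q where q: "p = s * q" ..
  have "s dvd monom 1 h - [:of_real (r ^ h):]"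
    unfolding s_def
  proof (rule prod_root_factors_dvd [OF \<open>finite Z\<close>])
    fix z assume "z \<in> Z"
    then obtain k where "z = of_real r * exp (2 * of_real pi * \<i> * of_nat k / of_nat h)"
      using cyc unfolding has_cyclicity_degree_def Z_def r_def by blast
    then have "z ^ h = of_real r ^ h * exp (of_nat h * (2 * of_real pi * \<i> * of_nat k / of_nat h))"
      by (simp only: power_mult_distrib exp_of_nat_mult)
    also have "of_nat h * (2 * of_real pi * \<i> * of_nat k / of_nat h) = 2 * of_real pi * \<i> * of_nat k"
      using \<open>1 \<le> h\<close> by simp
    also have "exp \<dots> = exp (2 * of_real pi * \<i>) ^ k"
      by (metis exp_of_nat2_mult)
    finally show "poly (monom 1 h - [:of_real (r ^ h):]) z = 0"
      by (simp add: poly_monom)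
  qed
  then obtain t where t: "monom 1 h - [:of_real (r ^ h):] = s * t" ..
  \<comment> \<open>A root of \<open>q\<close> on the circle of radius r is also a root of
    \<open>s\<close>, hence a double root of \<open>p\<close>.\<close>
  have small: "cmod z < r" if z: "poly q z = 0" for z
  proof (rule ccontr)
    assume "\<not> cmod z < r"
    moreover have "z \<in> spectrum A"
      using z by (simp add: spec q)
    ultimately have "cmod z = r"
      using rho(2) by force
    with \<open>z \<in> spectrum A\<close> have "z \<in> Z"
      by (simp add: Z_def)
    then have "s = [:- z, 1:] * (\<Prod>z\<in>Z - {z}. [:- z, 1:])"
      unfolding s_def using \<open>finite Z\<close> by (rule prod.remove [rotated])
    moreover obtain q' where "q = [:- z, 1:] * q'"
      using z by (metis dvdE poly_eq_0_iff_dvd)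
    ultimately have "p = [:- z, 1:] * ([:- z, 1:] * ((\<Prod>z\<in>Z - {z}. [:- z, 1:]) * q'))"
      unfolding q by (simp only: ac_simps)
    then show False
      using simple \<open>z \<in> spectrum A\<close> \<open>cmod z = r\<close> by blast
  qed
  have "q \<noteq> 0"
    using p(1) q by auto
  \<comment> \<open>Each entry is a coordinate of the image of \<open>axis j 1\<close>; taking real
    parts brings the complex limit back to the reals.\<close>
  have "convergent (\<lambda>k. matpow A (k * h) $ i $ j / r ^ (k * h))" for i j
  proof -
    have "(cmat B *v axis j 1) $ i = of_real (B $ i $ j)" for B :: "real^'n^'n"
      by (simp add: matrix_vector_mult_def axis_def if_distrib cong: if_cong)
    then have "convergent (\<lambda>k. complex_of_real (matpow A (k * h) $ i $ j) / of_real (r ^ (k * h)))"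
      using convergent_matpow [OF \<open>0 < r\<close> \<open>1 \<le> h\<close> \<open>q \<noteq> 0\<close> small _ t, of "cmat A" "axis j 1" i] p(2)
      by (simp add: cmat_matpow q)
    then obtain l where "(\<lambda>k. complex_of_real (matpow A (k * h) $ i $ j / r ^ (k * h))) \<longlonglongrightarrow> l"
      by (auto simp: convergent_def)
    from tendsto_Re [OF this] show ?thesis
      by (auto simp: convergent_def)
  qed
  then have lim: "(\<lambda>k. matpow A (k * h) $ i $ j / r ^ (k * h))
      \<longlonglongrightarrow> lim (\<lambda>k. matpow A (k * h) $ i $ j / r ^ (k * h))" for i j
    by (simp add: convergent_LIMSEQ_iff)
  have "(\<lambda>k. (1 / r ^ (k * h)) *\<^sub>R matpow A (k * h))
      \<longlonglongrightarrow> (\<chi> i j. lim (\<lambda>k. matpow A (k * h) $ i $ j / r ^ (k * h)))"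
    using lim by (intro vec_tendstoI) simp
  then show "convergent (\<lambda>k. (1 / spectral_radius A ^ (k * h)) *\<^sub>R matpow A (k * h))"
    by (auto simp: convergent_def r_def)
  show "\<exists>z\<in>spectrum A. cmod z = spectral_radius A"
    using rho(1) unfolding r_def by force
  show "0 < spectral_radius A"
    using \<open>0 < r\<close> by (simp add: r_def)
qed

section \<open>Limit vectors of the orbit of \<open>b\<close>\<close>

lemma tendsto_matrix_mult:
  fixes F :: "'b \<Rightarrow> real^'n^'m" and G :: "'b \<Rightarrow> real^'k^'n"
  assumes "(F \<longlongrightarrow> A) X" "(G \<longlongrightarrow> B) X"
  shows "((\<lambda>x. F x ** G x) \<longlongrightarrow> A ** B) X"
  unfolding matrix_matrix_mult_def by (intro tendsto_vec_lambda tendsto_intros assms)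

lemma tendsto_matrix_vector_mult:
  fixes F :: "'b \<Rightarrow> real^'n^'m"
  assumes "(F \<longlongrightarrow> A) X"
  shows "((\<lambda>x. F x *v v) \<longlongrightarrow> A *v v) X"
  unfolding matrix_vector_mult_def by (intro tendsto_vec_lambda tendsto_intros assms)

lemma scaleR_matrix_mult: "(c *\<^sub>R A) ** B = c *\<^sub>R (A ** B)" "A ** (c *\<^sub>R B) = c *\<^sub>R (A ** B)"
  for A :: "real^'n^'m" and B :: "real^'k^'n"
  by (simp_all add: vec_eq_iff matrix_matrix_mult_def sum_distrib_left ac_simps)

text \<open>With L the limit of the scaled powers \<open>B k\<close>, \<open>A_f A h i\<close> is L
  A^i and L commutes with the powers of A. So A moves each limit vector to the next, and after h
  steps the first one returns multiplied by r^h.\<close>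

lemma A_f_properties:
  fixes A :: "real^'n^'n"
  assumes r: "0 < spectral_radius A" and ev: "\<exists>z\<in>spectrum A. cmod z = spectral_radius A"
    and conv: "convergent (\<lambda>k. (1 / spectral_radius A ^ (k * h)) *\<^sub>R matpow A (k * h))"
    and rank: "rank (conmat A b :: real^'n^'n) = CARD('n)"
  shows "(\<lambda>k. (1 / spectral_radius A ^ (k * h)) *\<^sub>R (matpow A (k * h + i) *v b)) \<longlonglongrightarrow> A_f A h i *v b"
    and "A *v (A_f A h i *v b) = A_f A h (Suc i) *v b"
    and "A_f A h h *v b = spectral_radius A ^ h *\<^sub>R (A_f A h 0 *v b)"
    and "1 \<le> h \<Longrightarrow> i \<le> h \<Longrightarrow> A_f A h i *v b \<noteq> 0"
proof -
  define r where "r = spectral_radius A"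
  define B where "B k = (1 / r ^ (k * h)) *\<^sub>R matpow A (k * h)" for k
  obtain L where L: "B \<longlonglongrightarrow> L"
    using conv by (auto simp: convergent_def B_def [abs_def] r_def)
  have Af: "A_f A h i = L ** matpow A i" for i
    unfolding A_f_def r_def [symmetric] B_def [symmetric]
    by (intro limI tendsto_matrix_mult L tendsto_const)
  have Bcomm: "B k ** matpow A i = matpow A i ** B k" for k i
    by (simp add: B_def scaleR_matrix_mult matpow_commute)
  have comm: "L ** matpow A i = matpow A i ** L" for i
  proof (rule LIMSEQ_unique)
    show "(\<lambda>k. B k ** matpow A i) \<longlonglongrightarrow> L ** matpow A i"
      by (intro tendsto_matrix_mult L tendsto_const)
    show "(\<lambda>k. B k ** matpow A i) \<longlonglongrightarrow> matpow A i ** L"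
      unfolding Bcomm by (intro tendsto_matrix_mult L tendsto_const)
  qed
  have "(\<lambda>k. B k ** matpow A i *v b) \<longlonglongrightarrow> A_f A h i *v b"
    unfolding Af by (intro tendsto_matrix_vector_mult tendsto_matrix_mult L tendsto_const)
  then show "(\<lambda>k. (1 / spectral_radius A ^ (k * h)) *\<^sub>R (matpow A (k * h + i) *v b)) \<longlonglongrightarrow> A_f A h i *v b"
    by (simp add: B_def r_def scaleR_matrix_mult matpow_add scaleR_matrix_vector_assoc)
  show step: "A *v (A_f A h i *v b) = A_f A h (Suc i) *v b" for i
    using comm [of 1] by (simp add: Af matrix_vector_mul_assoc matrix_mul_assoc)
  have "B k ** matpow A h = r ^ h *\<^sub>R B (Suc k)" for k
    using r by (simp add: B_def r_def scaleR_matrix_mult add.commute [of h] power_add flip: matpow_add)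
  moreover have "(\<lambda>k. r ^ h *\<^sub>R B (Suc k)) \<longlonglongrightarrow> r ^ h *\<^sub>R L"
    by (intro tendsto_intros LIMSEQ_Suc L)
  moreover have "(\<lambda>k. B k ** matpow A h) \<longlonglongrightarrow> A_f A h h"
    unfolding Af by (intro tendsto_matrix_mult L tendsto_const)
  ultimately have "A_f A h h = r ^ h *\<^sub>R L"
    using LIMSEQ_unique by auto
  then show period: "A_f A h h *v b = spectral_radius A ^ h *\<^sub>R (A_f A h 0 *v b)"
    by (simp add: Af r_def scaleR_matrix_vector_assoc)
  have nz: "L *v b \<noteq> 0"
  proof
    assume "L *v b = 0"
    \<comment> \<open>L commutes with the powers of A, so it kills the whole orbit of
      \<open>b\<close>, which spans the space.\<close>
    then have Ab: "L *v (matpow A i *v b) = 0" for i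
      by (simp add: matrix_vector_mul_assoc comm flip: matrix_vector_mul_assoc [of "matpow A i" L])
    have "L *v x = 0" for x
    proof -
      obtain c :: "real^'n" where "x = (\<Sum>j\<in>UNIV. c $ j *s (matpow A (idx j) *v b))"
        by (rule conmat_spans [OF rank])
      then show ?thesis
        by (simp add: vec.sum vec.scale Ab)
    qed
    then have "L = 0"
      by (simp add: matrix_eq)
    obtain z u where z: "cmod z = r" and u: "u \<noteq> 0" "cmat A *v u = z *s u"
      using ev by (auto simp: spectrum_def r_def)
    obtain i where i: "u $ i \<noteq> 0"
      using \<open>u \<noteq> 0\<close> by (auto simp: vec_eq_iff)
    have pow: "cmat (matpow A k) *v u = z ^ k *s u" for k
      using poly_act_eigenvector [OF u(2), of "monom 1 k"]
      by (simp add: poly_act_monom cmat_matpow poly_monom)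
    have "(cmat (B k) *v u) $ i = (cmat (matpow A (k * h)) *v u) $ i / of_real (r ^ (k * h))" for k
      by (simp add: B_def matrix_vector_mult_def sum_divide_distrib)
    \<comment> \<open>Since |z| = r, \<open>B k\<close> multiplies \<open>u\<close> by a number of
      modulus 1, so this modulus cannot tend to 0.\<close>
    then have "cmod ((cmat (B k) *v u) $ i) = cmod (u $ i)" for k
      using r by (simp add: pow norm_divide norm_mult norm_power z r_def)
    moreover have "(\<lambda>k. cmod ((cmat (B k) *v u) $ i)) \<longlonglongrightarrow> cmod ((cmat L *v u) $ i)"
      unfolding matrix_vector_mult_def nth_map_matrix
      by (simp, intro tendsto_intros L)
    ultimately show False
      using i by (simp add: \<open>L = 0\<close> LIMSEQ_const_iff matrix_vector_mult_def)
  qed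
  show "A_f A h i *v b \<noteq> 0" if "1 \<le> h" "i \<le> h"
  proof
    assume "A_f A h i *v b = 0"
    \<comment> \<open>Applying A carries the zero from index i up to index h, where
      \<open>period\<close> turns it into L b = 0.\<close>
    then have "A_f A h (i + j) *v b = 0" for j
      by (induction j) (auto simp flip: step)
    from this [of "h - i"] \<open>i \<le> h\<close> have "A_f A h h *v b = 0"
      by simp
    with period r nz show False
      by (simp add: Af)
  qed
qed

subsection \<open>Controllable subsets as cones\<close>

lemma cone_gen_mono: "S \<subseteq> T \<Longrightarrow> cone_gen S \<subseteq> cone_gen T"
  by (simp add: cone_gen_eq_convex_cone_hull hull_mono)

lemma cone_gen_superset: "S \<subseteq> cone_gen S"
  by (simp add: cone_gen_eq_convex_cone_hull hull_subset)

lemma convex_cone_cone_gen: "convex_cone (cone_gen S)"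
  by (simp add: cone_gen_eq_convex_cone_hull convex_cone_convex_cone_hull)

lemma cone_gen_minimal: "S \<subseteq> C \<Longrightarrow> convex_cone C \<Longrightarrow> cone_gen S \<subseteq> C"
  by (simp add: cone_gen_eq_convex_cone_hull hull_minimal)

lemma cone_gen_subset_iff: "cone_gen S \<subseteq> cone_gen T \<longleftrightarrow> S \<subseteq> cone_gen T"
  by (simp add: cone_gen_eq_convex_cone_hull subset_hull convex_cone_convex_cone_hull)

lemma convex_cone_sum:
  assumes "convex_cone C" "\<And>i. i \<in> I \<Longrightarrow> f i \<in> C"
  shows "sum f I \<in> C"
  using assms(2)
  by (induction I rule: infinite_finite_induct)
    (auto simp: convex_cone_contains_0 convex_cone_add assms(1))

lemma cone_gen_Un_left: "cone_gen (cone_gen S \<union> T) = cone_gen (S \<union> T)"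
  by (simp add: cone_gen_eq_convex_cone_hull flip: hull_Un_left)

lemma cone_gen_Un_right: "cone_gen (S \<union> cone_gen T) = cone_gen (S \<union> T)"
  by (simp add: cone_gen_eq_convex_cone_hull flip: hull_Un_right)

text \<open>The generated cone is 0 together with the rays through the convex hull, which is compact
  and misses 0.\<close>

lemma closed_cone_gen_compact:
  fixes S :: "'a::euclidean_space set"
  assumes "compact S" "0 \<notin> convex hull S"
  shows "closed (cone_gen S)"
  unfolding cone_gen_eq_convex_cone_hull convex_cone_hull_separate
  using assms by (intro closed_insert closed_conic_hull) (auto intro: compact_convex_hull)

text \<open>The vectors A^i b may coincide, so coefficients are not matched one by one; both
  inclusions use closure under cone operations.\<close>

lemma Conset_eq_cone_gen: "Conset k A b = cone_gen ((\<lambda>i. matpow A i *v b) ` {0..<k})"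
  (is "_ = cone_gen (?x ` _)")
proof
  show "Conset k A b \<subseteq> cone_gen (?x ` {0..<k})"
  proof
    fix y assume "y \<in> Conset k A b"
    then obtain u :: "nat \<Rightarrow> real" where u: "\<forall>t<k. 0 \<le> u t"
      and y: "y = (\<Sum>i=1..k. u (k - i) *\<^sub>R ?x (i - 1))"
      by (auto simp: Conset_def)
    show "y \<in> cone_gen (?x ` {0..<k})"
      unfolding y
    proof (intro convex_cone_sum convex_cone_scaleR convex_cone_cone_gen)
      fix i assume i: "i \<in> {1..k}"
      then show "0 \<le> u (k - i)"
        using u by auto
      show "?x (i - 1) \<in> cone_gen (?x ` {0..<k})"
        using i by (intro subsetD [OF cone_gen_superset] imageI) auto
    qed
  qed
next
  show "cone_gen (?x ` {0..<k}) \<subseteq> Conset k A b"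
  proof (rule cone_gen_minimal)
    show "?x ` {0..<k} \<subseteq> Conset k A b"
    proof
      fix y assume "y \<in> ?x ` {0..<k}"
      then obtain j where j: "j < k" "y = ?x j"
        by auto
      \<comment> \<open>A single unit input at time k - (j + 1) produces A^j b; truncated
        subtraction is harmless as i and j + 1 are at most k.\<close>
      have "(\<Sum>i=1..k. (if k - i = k - Suc j then 1 else 0) *\<^sub>R ?x (i - 1))
        = (\<Sum>i\<in>{Suc j}. ?x (i - 1))"
        using j by (intro sum.mono_neutral_cong_right) auto
      then have "y = (\<Sum>i=1..k. (if k - i = k - Suc j then 1 else 0) *\<^sub>R ?x (i - 1))"
        using j by simp
      then show "y \<in> Conset k A b"
        unfolding Conset_def by (intro CollectI exI [of _ "\<lambda>t. if t = k - Suc j then 1 else 0"]) auto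
    qed
    show "convex_cone (Conset k A b)"
      unfolding convex_cone_iff
    proof (intro conjI allI ballI impI)
      show "0 \<in> Conset k A b"
        unfolding Conset_def by (intro CollectI exI [of _ "\<lambda>_. 0"]) auto
    next
      fix x y assume "x \<in> Conset k A b" "y \<in> Conset k A b"
      then obtain u w where "\<forall>t<k. 0 \<le> u t" "x = (\<Sum>i=1..k. u (k - i) *\<^sub>R ?x (i - 1))"
        "\<forall>t<k. 0 \<le> w t" "y = (\<Sum>i=1..k. w (k - i) *\<^sub>R ?x (i - 1))"
        unfolding Conset_def by blast
      then show "x + y \<in> Conset k A b"
        unfolding Conset_def
        by (intro CollectI exI [of _ "\<lambda>t. u t + w t"]) (auto simp: scaleR_add_left sum.distrib)
    next
      fix x and c :: real assume "x \<in> Conset k A b" "0 \<le> c"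
      then obtain u where "\<forall>t<k. 0 \<le> u t" "x = (\<Sum>i=1..k. u (k - i) *\<^sub>R ?x (i - 1))"
        unfolding Conset_def by blast
      then show "c *\<^sub>R x \<in> Conset k A b"
        unfolding Conset_def using \<open>0 \<le> c\<close>
        by (intro CollectI exI [of _ "\<lambda>t. c * u t"]) (auto simp: scaleR_sum_right)
    qed
  qed
qed

lemma in_cone_gen_finite:
  assumes "x \<in> cone_gen S"
  obtains T where "finite T" "T \<subseteq> S" "x \<in> cone_gen T"
  using assms unfolding cone_gen_def by blast

lemma Conset_f_eq_cone_gen: "Conset_f A b = cone_gen (range (\<lambda>i. matpow A i *v b))"
  (is "_ = cone_gen (range ?x)")
proof
  show "Conset_f A b \<subseteq> cone_gen (range ?x)"
    unfolding Conset_f_def Conset_eq_cone_gen by (intro UN_least cone_gen_mono) auto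
  show "cone_gen (range ?x) \<subseteq> Conset_f A b"
  proof
    fix y assume "y \<in> cone_gen (range ?x)"
    then obtain T where T: "finite T" "T \<subseteq> range ?x" "y \<in> cone_gen T"
      by (rule in_cone_gen_finite)
    then obtain I where I: "finite I" "T = ?x ` I"
      by (meson finite_subset_image)
    then obtain k where "I \<subseteq> {..<k}"
      using finite_nat_iff_bounded by blast
    \<comment> \<open>\<open>Suc k\<close> because the union in \<open>Conset_f\<close> starts at
      horizon 1.\<close>
    then have "cone_gen T \<subseteq> Conset (Suc k) A b"
      unfolding Conset_eq_cone_gen I(2) by (intro cone_gen_mono image_mono) auto
    then show "y \<in> Conset_f A b"
      using T(3) unfolding Conset_f_def by (intro UN_I [of "Suc k"]) auto
  qed
qed

lemma convex_cone_closure: "convex_cone C \<Longrightarrow> convex_cone (closure C)"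
  for C :: "'a::euclidean_space set"
  by (auto simp: convex_cone_def conic_closure)

text \<open>Passing from horizon k to k + 1 adds the single generator A^k b.\<close>

lemma cone_gen_Conset_subset_iff:
  "cone_gen (Conset (k + 1) A b \<union> C_lim A h b) \<subseteq> cone_gen (Conset k A b \<union> C_lim A h b)
    \<longleftrightarrow> matpow A k *v b \<in> cone_gen ((\<lambda>i. matpow A i *v b) ` {0..<k} \<union> C_lim A h b)"
    (is "?L \<longleftrightarrow> _ \<in> ?K")
proof -
  have eq: "cone_gen (Conset k A b \<union> C_lim A h b)
      = cone_gen ((\<lambda>i. matpow A i *v b) ` {0..<k} \<union> C_lim A h b)" for k
    by (simp only: Conset_eq_cone_gen cone_gen_Un_left)
  have "?L \<longleftrightarrow> (\<lambda>i. matpow A i *v b) ` {0..<k + 1} \<union> C_lim A h b \<subseteq> ?K"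
    unfolding eq by (rule cone_gen_subset_iff)
  also have "\<dots> \<longleftrightarrow> matpow A k *v b \<in> ?K"
    using cone_gen_superset [of "(\<lambda>i. matpow A i *v b) ` {0..<k} \<union> C_lim A h b"]
    by (auto simp: atLeast0_lessThan_Suc)
  finally show ?thesis .
qed

lemma nonneg_matpow_vec:
  assumes "nonneg_mat A" "nonneg_vec b"
  shows "nonneg_vec (matpow A k *v b)"
proof (induction k)
  case (Suc k)
  have "nonneg_vec (A *v (matpow A k *v b))"
    using assms(1) Suc
    by (auto simp: nonneg_vec_def nonneg_mat_def matrix_vector_mult_def intro!: sum_nonneg)
  then show ?case
    by (simp add: matrix_vector_mul_assoc)
qed (simp add: assms)

text \<open>The coordinate sum, which is the inner product with the constant vector 1, is positive
  on \<open>S\<close> and hence on its hull.\<close>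

lemma zero_notin_convex_hull_nonneg:
  assumes "\<And>v. v \<in> S \<Longrightarrow> nonneg_vec v \<and> v \<noteq> 0"
  shows "0 \<notin> convex hull S"
proof -
  have "convex hull S \<subseteq> {v. 0 < inner 1 v}"
  proof (rule hull_minimal)
    show "S \<subseteq> {v. 0 < inner 1 v}"
    proof safe
      fix v assume "v \<in> S"
      then have v: "\<forall>i. 0 \<le> v $ i" "v \<noteq> 0"
        using assms by (auto simp: nonneg_vec_def)
      then obtain i where "v $ i \<noteq> 0"
        by (auto simp: vec_eq_iff)
      with v(1) have "0 < sum (($) v) UNIV"
        by (intro sum_pos2 [of _ i]) (auto simp: less_le)
      then show "0 < inner 1 v"
        by (simp add: inner_vec_def)
    qed
    show "convex {v. 0 < inner (1 :: real^'n) v}"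
      by (rule convex_halfspace_gt)
  qed
  then show ?thesis by auto
qed

section \<open>The polyhedrality criterion\<close>

lemma polyhedral_Conset_inf_iff:
  fixes A :: "real^'n^'n"
  assumes "nonneg_mat A" "irreducible_mat A" "has_cyclicity_degree A h" "nonneg_vec b"
    and rank: "rank (conmat A b :: real^'n^'n) = CARD('n)"
  shows "polyhedral_cone (Conset_inf A b) \<longleftrightarrow>
    (\<exists>k\<ge>1. matpow A k *v b \<in> cone_gen ((\<lambda>i. matpow A i *v b) ` {0..<k} \<union> C_lim A h b))"
proof -
  define r where "r = spectral_radius A"
  note lims = cyclicity_degree_limit [OF assms(2,3) rank]
  note Af = A_f_properties [OF lims rank, folded r_def]
  have r: "0 < r"
    unfolding r_def by (rule lims)
  have h: "1 \<le> h"
    using assms(3) by (simp add: has_cyclicity_degree_def)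
  \<comment> \<open>Here \<open>x i\<close> is the unscaled power A^i b; the scaling enters with
    \<open>y\<close> below.\<close>
  define x where "x i = matpow A i *v b" for i
  define D where "D = (\<lambda>i. A_f A h i *v b) ` {0..<h}"
  have C_lim: "C_lim A h b = cone_gen D"
    by (simp add: C_lim_def D_def)
  have absorb: "cone_gen (S \<union> C_lim A h b) = cone_gen (S \<union> D)" for S
    by (simp only: C_lim cone_gen_Un_right)
  have inf: "Conset_inf A b = closure (cone_gen (range x))"
    by (simp add: Conset_inf_def Conset_f_eq_cone_gen x_def)
  have x_Suc: "x (Suc i) = A *v x i" for i
    by (simp add: x_def matrix_vector_mul_assoc)
  have cc: "convex_cone (Conset_inf A b)"
    unfolding inf by (intro convex_cone_closure convex_cone_cone_gen)
  have x_in: "range x \<subseteq> Conset_inf A b"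
    unfolding inf by (meson cone_gen_superset closure_subset order_trans)
  have lim_in: "A_f A h i *v b \<in> Conset_inf A b" for i
  proof (rule closed_sequentially [OF _ _ Af(1) [of i]])
    show "closed (Conset_inf A b)"
      by (simp add: inf)
    show "(1 / r ^ (k * h)) *\<^sub>R (matpow A (k * h + i) *v b) \<in> Conset_inf A b" for k
      using x_in r by (intro convex_cone_scaleR cc) (auto simp: x_def)
  qed
  have "polyhedral_cone (Conset_inf A b)"
    if k: "x k \<in> cone_gen (x ` {0..<k} \<union> D)" (is "_ \<in> ?K") for k
  proof -
    \<comment> \<open>Invariance is checked on generators: A shifts the powers, the last one landing
      on \<open>x k\<close>, and moves \<open>D\<close> cyclically up to the positive factor
      r^h.\<close>
    have "?K \<subseteq> {y. A *v y \<in> ?K}"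
    proof (rule cone_gen_minimal)
      show "convex_cone {y. A *v y \<in> ?K}"
        using convex_cone_cone_gen [of "x ` {0..<k} \<union> D"]
        by (auto simp: convex_cone_iff matrix_vector_right_distrib matrix_vector_mult_scaleR)
      have "A *v x i \<in> ?K" if "i < k" for i
      proof -
        have "x (Suc i) \<in> ?K"
        proof (cases "Suc i = k")
          case False
          then show ?thesis
            using that by (intro subsetD [OF cone_gen_superset]) auto
        qed (use k in simp)
        then show ?thesis
          by (simp add: x_Suc)
      qed
      moreover have "A *v (A_f A h i *v b) \<in> ?K" if "i < h" for i
      proof (cases "Suc i = h")
        case True
        have "A_f A h 0 *v b \<in> ?K"
          using h by (intro subsetD [OF cone_gen_superset]) (auto simp: D_def)
        then show ?thesis
          using True r by (auto simp: Af(2,3) intro: convex_cone_scaleR convex_cone_cone_gen)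
      next
        case False
        then show ?thesis
          using that by (intro subsetD [OF cone_gen_superset]) (auto simp: Af(2) D_def)
      qed
      ultimately show "x ` {0..<k} \<union> D \<subseteq> {y. A *v y \<in> ?K}"
        by (auto simp: D_def)
    qed
    then have inv: "A *v y \<in> ?K" if "y \<in> ?K" for y
      using that by auto
    \<comment> \<open>For k = 0 this is the hypothesis on \<open>x k\<close> itself.\<close>
    have "x 0 \<in> ?K"
      using k by (cases "k = 0") (auto intro: subsetD [OF cone_gen_superset])
    then have "x j \<in> ?K" for j
      by (induction j) (auto intro: inv simp: x_Suc)
    then have "cone_gen (range x) \<subseteq> ?K"
      by (intro cone_gen_minimal convex_cone_cone_gen) auto
    moreover have "closed ?K"
      by (simp add: cone_gen_eq_convex_cone_hull closed_convex_cone_hull D_def)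
    ultimately have "Conset_inf A b \<subseteq> ?K"
      unfolding inf by (rule closure_minimal)
    moreover have "?K \<subseteq> Conset_inf A b"
      using x_in lim_in by (intro cone_gen_minimal cc) (auto simp: D_def)
    ultimately have "Conset_inf A b = ?K"
      by auto
    then show ?thesis
      unfolding polyhedral_cone_def by (intro exI [of _ "x ` {0..<k} \<union> D"]) (auto simp: D_def)
  qed
  moreover have "\<exists>k\<ge>1. x k \<in> cone_gen (x ` {0..<k} \<union> D)"
    if "polyhedral_cone (Conset_inf A b)"
  proof -
    \<comment> \<open>Dividing by r^(kh) instead of r^(kh+i) makes the limit of \<open>y i\<close>
      exactly \<open>A_f A h i\<close> applied to \<open>b\<close>; the rays are the same.\<close>
    define y where "y i k = (1 / r ^ (k * h)) *\<^sub>R x (k * h + i)" for i k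
    define G where "G = (\<Union>i\<in>{0..<h}. insert (A_f A h i *v b) (range (y i)))"
    have y_lim: "y i \<longlonglongrightarrow> A_f A h i *v b" for i
      using Af(1) by (simp add: y_def [abs_def] x_def)
    have "compact G"
      unfolding G_def by (intro compact_UN compact_sequence_with_limit y_lim) auto
    \<comment> \<open>One vanishing power would annihilate all later ones, so \<open>y 0\<close>
      would tend to 0, against its nonzero limit.\<close>
    have x_nz: "x j \<noteq> 0" for j
    proof
      assume "x j = 0"
      then have "x (i + j) = 0" for i
        by (simp add: x_def matpow_add flip: matrix_vector_mul_assoc)
      then have z: "x i = 0" if "j \<le> i" for i
        using that by (metis le_add_diff_inverse2)
      have "eventually (\<lambda>k. y 0 k = 0) sequentially"
        using eventually_ge_at_top [of j]
      proof eventually_elim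
        case (elim k)
        have "k * 1 \<le> k * h"
          using h by (intro mult_le_mono2)
        with elim have "j \<le> k * h"
          by linarith
        then show ?case
          by (simp add: y_def z)
      qed
      then have "y 0 \<longlonglongrightarrow> 0"
        by (rule tendsto_eventually)
      then show False
        using LIMSEQ_unique [OF y_lim [of 0]] Af(4) [OF h] by auto
    qed
    have y_nonneg: "nonneg_vec (y i k)" for i k
      using nonneg_matpow_vec [OF assms(1,4)] r by (simp add: y_def x_def nonneg_vec_def)
    have "nonneg_vec (A_f A h i *v b)" for i
      unfolding nonneg_vec_def
    proof
      fix l
      show "0 \<le> (A_f A h i *v b) $ l"
        using tendsto_vec_nth [OF y_lim [of i], of l] y_nonneg [of i]
        by (intro LIMSEQ_le_const [of "\<lambda>k. y i k $ l"]) (auto simp: nonneg_vec_def)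
    qed
    then have "0 \<notin> convex hull G"
      using y_nonneg x_nz r Af(4) [OF h]
      by (intro zero_notin_convex_hull_nonneg) (auto simp: G_def y_def)
    with \<open>compact G\<close> have "closed (cone_gen G)"
      by (rule closed_cone_gen_compact)
    have G_sub: "G \<subseteq> cone_gen (range x \<union> D)"
    proof -
      have "y i k \<in> cone_gen (range x \<union> D)" for i k
        unfolding y_def using r
        by (intro convex_cone_scaleR convex_cone_cone_gen subsetD [OF cone_gen_superset]) auto
      then show ?thesis
        using cone_gen_superset [of "range x \<union> D"] by (auto simp: G_def D_def)
    qed
    have "x j \<in> cone_gen G" for j
    proof -
      \<comment> \<open>Division of j by h locates each power in one of the h subsequences.\<close>
      have "x j = r ^ (j div h * h) *\<^sub>R y (j mod h) (j div h)"
        using r by (simp add: y_def)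
      moreover have "y (j mod h) (j div h) \<in> cone_gen G"
        using h by (intro subsetD [OF cone_gen_superset]) (auto simp: G_def intro!: bexI [of _ "j mod h"])
      ultimately show ?thesis
        using r by (auto intro: convex_cone_scaleR convex_cone_cone_gen)
    qed
    then have "cone_gen (range x) \<subseteq> cone_gen G"
      by (intro cone_gen_minimal convex_cone_cone_gen) auto
    then have "Conset_inf A b \<subseteq> cone_gen G"
      unfolding inf using \<open>closed (cone_gen G)\<close> by (rule closure_minimal)
    also have "\<dots> \<subseteq> cone_gen (range x \<union> D)"
      using G_sub by (rule cone_gen_minimal) (rule convex_cone_cone_gen)
    finally have sub: "Conset_inf A b \<subseteq> cone_gen (range x \<union> D)" .
    obtain F where F: "finite F" "Conset_inf A b = cone_gen F"
      using \<open>polyhedral_cone _\<close> by (auto simp: polyhedral_cone_def)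
    have "\<exists>k. f \<in> cone_gen (x ` {0..<k} \<union> D)" if "f \<in> F" for f
    proof -
      have "f \<in> cone_gen (range x \<union> D)"
        using that sub F(2) cone_gen_superset by blast
      then obtain T where T: "finite T" "T \<subseteq> range x \<union> D" "f \<in> cone_gen T"
        by (rule in_cone_gen_finite)
      then obtain I where I: "finite I" "T - D = x ` I"
        using finite_subset_image [of "T - D" x UNIV] by auto
      then obtain k where "I \<subseteq> {..<k}"
        using finite_nat_iff_bounded by blast
      then have "T \<subseteq> x ` {0..<k} \<union> D"
        using I(2) by force
      then show ?thesis
        using T(3) cone_gen_mono by blast
    qed
    then obtain m where m: "\<And>f. f \<in> F \<Longrightarrow> f \<in> cone_gen (x ` {0..<m f} \<union> D)"
      by metis
    \<comment> \<open>The sum dominates every \<open>m f\<close>, and \<open>Suc\<close> gives k >=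
      1 even when \<open>F\<close> is empty.\<close>
    define k where "k = Suc (\<Sum>f\<in>F. m f)"
    have "F \<subseteq> cone_gen (x ` {0..<k} \<union> D)"
    proof
      fix f assume f: "f \<in> F"
      then have "m f \<le> k"
        using F(1) by (simp add: k_def le_SucI member_le_sum)
      then have "cone_gen (x ` {0..<m f} \<union> D) \<subseteq> cone_gen (x ` {0..<k} \<union> D)"
        by (intro cone_gen_mono Un_mono image_mono) auto
      with m [OF f] show "f \<in> cone_gen (x ` {0..<k} \<union> D)"
        by auto
    qed
    then have "Conset_inf A b \<subseteq> cone_gen (x ` {0..<k} \<union> D)"
      unfolding F(2) by (intro cone_gen_minimal convex_cone_cone_gen)
    \<comment> \<open>\<open>x k\<close> is itself in the controllable subset, hence in this
      cone.\<close>
    then show ?thesis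
      using x_in by (intro exI [of _ k]) (auto simp: k_def)
  qed
  ultimately show ?thesis
    unfolding absorb x_def [symmetric] by blast
qed

theorem proposition2:
  fixes A :: "real^'n^'n" and b :: "real^'n" and h :: nat
  assumes "nonneg_mat A"
    and "irreducible_mat A"
    and "has_cyclicity_degree A h"
    and "nonneg_vec b"
    and "rank (conmat A b :: real^'n^'n) = CARD('n)"
  shows "(polyhedral_cone (Conset_inf A b) \<longleftrightarrow>
            (\<exists>k\<ge>1. cone_gen (Conset (k + 1) A b \<union> C_lim A h b)
                      \<subseteq> cone_gen (Conset k A b \<union> C_lim A h b)))
       \<and> (polyhedral_cone (Conset_inf A b) \<longleftrightarrow>
            (\<exists>k\<ge>1. matpow A k *v b
                      \<in> cone_gen ((\<lambda>i. matpow A i *v b) ` {0..<k} \<union> C_lim A h b)))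
       \<and> (\<forall>k\<ge>1. cone_gen (Conset (k + 1) A b \<union> C_lim A h b)
                      \<subseteq> cone_gen (Conset k A b \<union> C_lim A h b)
             \<longleftrightarrow> matpow A k *v b
                   \<in> cone_gen ((\<lambda>i. matpow A i *v b) ` {0..<k} \<union> C_lim A h b))"
  unfolding cone_gen_Conset_subset_iff polyhedral_Conset_inf_iff [OF assms] by blast

end
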